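(* Let $\lambda>0$, let $g\colon\mathbb{R}^n\to\mathbb{R}\cup\{\infty\}$ be closed, convex, and proper, and let $g_\star=\inf_{x\in\mathbb{R}^n}g(x)$. Let $K\ge1$ be an integer. Let $\{\varphi_k\}_{k=0}^{K+1}$ be a nonnegative sequence and $\{\tau_k\}_{k=0}^{K}$ a nondecreasing nonnegative sequence such that $\varphi_{K+1}=0$, $\varphi_K=\tau_K=1$, and, for $k=0,1,\dots,K-1$, $$\tau_k\varphi_k-\tau_{k+1}\varphi_{k+1}=\varphi_{k+1}(\tau_{k+1}-\tau_k)+1,\qquad(\tau_k\varphi_k-\tau_{k+1}\varphi_{k+1})(\tau_{k+1}-\tau_k)\le\tau_{k+1}.$$ Let $x_0\in\mathbb{R}^n$, $z_0=x_0$, $x_{-1}^{\circ}:=x_0$, and let the iterates be generated by G-Güler-G: $$x_k=\frac{\varphi_{k+1}}{\varphi_k}x_{k-1}^{\circ}+\left(1-\frac{\varphi_{k+1}}{\varphi_k}\right)z_k\quad(k=0,\dots,K),\qquad z_{k+1}=z_k-(\tau_k\varphi_k-\tau_{k+1}\varphi_{k+1})\lambda\tilde\nabla_{1/\lambda}g(x_k)\quad(k=0,\dots,K-1).$$ Then $$\|\tilde\nabla_{1/\lambda}g(x_K)\|^2\le\frac{\tau_0}{\lambda}\left(g(x_0)-g_\star\right).$$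
   Context: $\|\cdot\|$ is the Euclidean norm. $x^\circ=\operatorname{Prox}_{\lambda g}(x)=\operatorname*{arg\,min}_{y\in\mathbb{R}^n}\{g(y)+\frac1{2\lambda}\|y-x\|^2\}$, $x_k^\circ=(x_k)^\circ$ for $k\ge0$, and $\tilde\nabla_{1/\lambda}g(x):=-\frac1\lambda(x^\circ-x)$. *)

theory Defs
  imports "HOL-Analysis.Analysis"
begin

text \<open>
  Functions into the reals extended by plus infinity are modelled as \<^typ>\<open>ereal\<close>-valued
  functions; the value minus infinity is excluded by properness.
\<close>

definition proper_fun :: "('a \<Rightarrow> ereal) \<Rightarrow> bool" where
  "proper_fun g \<longleftrightarrow> (\<forall>x. g x \<noteq> -\<infinity>) \<and> (\<exists>x. g x \<noteq> \<infinity>)"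

definition closed_fun :: "('a::topological_space \<Rightarrow> ereal) \<Rightarrow> bool" where
  "closed_fun g \<longleftrightarrow> closed {(x, t::real). g x \<le> ereal t}"

text \<open>
  Intended for functions that do not attain minus infinity, so that no indeterminate
  sum occurs on the right-hand side.
\<close>

definition convex_fun :: "('a::real_vector \<Rightarrow> ereal) \<Rightarrow> bool" where
  "convex_fun g \<longleftrightarrow> (\<forall>x y. \<forall>\<theta>\<in>{0..1}.
     g (\<theta> *\<^sub>R x + (1 - \<theta>) *\<^sub>R y) \<le> ereal \<theta> * g x + ereal (1 - \<theta>) * g y)"

text \<open>
  For closed, convex, proper \<open>g\<close> and \<open>\<lambda> > 0\<close> the minimizer exists and is unique, so the choice
  in \<^const>\<open>arg_min\<close> is immaterial.
\<close>

definition prox :: "real \<Rightarrow> ('a::real_normed_vector \<Rightarrow> ereal) \<Rightarrow> 'a \<Rightarrow> 'a" where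
  "prox lam g x = (ARG_MIN (\<lambda>y. g y + ereal (1 / (2 * lam) * (norm (y - x))\<^sup>2)) y. True)"

definition prox_grad :: "real \<Rightarrow> ('a::real_normed_vector \<Rightarrow> ereal) \<Rightarrow> 'a \<Rightarrow> 'a" where
  "prox_grad lam g x = - ((1 / lam) *\<^sub>R (prox lam g x - x))"

text \<open>
  The point obtained by applying the proximal map to the iterate preceding \<open>x k\<close>, with the
  convention that for \<open>k = 0\<close> (index minus one) it is the starting point \<open>x 0\<close>.
\<close>

definition prev_prox ::
  "real \<Rightarrow> ('a::real_normed_vector \<Rightarrow> ereal) \<Rightarrow> (nat \<Rightarrow> 'a) \<Rightarrow> nat \<Rightarrow> 'a" where
  "prev_prox lam g x k = (case k of 0 \<Rightarrow> x 0 | Suc j \<Rightarrow> prox lam g (x j))"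

definition g_guler_g ::
  "real \<Rightarrow> ('a::real_normed_vector \<Rightarrow> ereal) \<Rightarrow> nat \<Rightarrow> (nat \<Rightarrow> real) \<Rightarrow> (nat \<Rightarrow> real)
    \<Rightarrow> (nat \<Rightarrow> 'a) \<Rightarrow> (nat \<Rightarrow> 'a) \<Rightarrow> bool" where
  "g_guler_g lam g K \<phi> \<tau> x z \<longleftrightarrow>
     z 0 = x 0 \<and>
     (\<forall>k\<le>K. x k = (\<phi> (k + 1) / \<phi> k) *\<^sub>R prev_prox lam g x k
                  + (1 - \<phi> (k + 1) / \<phi> k) *\<^sub>R z k) \<and>
     (\<forall>k<K. z (k + 1) = z k
        - ((\<tau> k * \<phi> k - \<tau> (k + 1) * \<phi> (k + 1)) * lam) *\<^sub>R prox_grad lam g (x k))"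

end

theory Submission
  imports Defs
begin

text \<open>
  Write \<open>y\<^sub>k\<close> for the proximal point of \<open>x\<^sub>k\<close>, \<open>p\<^sub>k = y\<^bsub>k-1\<^esub>\<close> (with \<open>p\<^sub>0 = x\<^sub>0\<close>) and
  \<open>u\<^sub>k = (x\<^sub>k - y\<^sub>k) / \<lambda>\<close>, which is a subgradient of \<open>g\<close> at \<open>y\<^sub>k\<close>. Put
  \<open>w\<^sub>k = (z\<^sub>k - p\<^sub>k) / \<phi>\<^sub>k\<close>; the first condition on the parameters turns the recursion into
  \<open>w\<^bsub>k+1\<^esub> = w\<^sub>k - (\<tau>\<^bsub>k+1\<^esub> - \<tau>\<^sub>k) \<lambda> u\<^sub>k\<close>. Then
  \<open>U\<^sub>k = \<tau>\<^sub>k (g p\<^sub>k - g y\<^sub>K) + \<langle>w\<^sub>k, z\<^sub>k - y\<^sub>K\<rangle> / \<lambda>\<close> is nonincreasing, by the subgradient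
  inequalities of \<open>u\<^sub>k\<close> at \<open>p\<^sub>k\<close> and at \<open>y\<^sub>K\<close>. Finally \<open>U\<^sub>0 = \<tau>\<^sub>0 (g x\<^sub>0 - g y\<^sub>K)\<close>, while
  \<open>U\<^sub>K \<ge> \<lambda> \<parallel>u\<^sub>K\<parallel>\<^sup>2\<close> by the subgradient inequality of \<open>u\<^sub>K\<close> at \<open>p\<^sub>K\<close>.
\<close>

section \<open>Attainment of minima and existence of proximal points\<close>

text \<open>Without a minimum, the open sets \<open>{y. t < f y}\<close> with \<open>t\<close> above
  some value of \<open>f\<close> on \<open>C\<close> would cover \<open>C\<close>. In a finite
  subcover, a point of \<open>C\<close> with value below the least \<open>t\<close> would be left
  uncovered.\<close>

lemma compact_attains_inf_of_closed_sublevels: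
  fixes f :: "'a::topological_space \<Rightarrow> ereal"
  assumes "compact C" and "C \<noteq> {}" and closed: "\<And>t::real. closed {y. f y \<le> ereal t}"
  shows "\<exists>m\<in>C. \<forall>y\<in>C. f m \<le> f y"
proof (rule ccontr)
  assume no_min: "\<not> ?thesis"
  define T where "T = {t::real. \<exists>y\<in>C. f y < ereal t}"
  have op: "open {y. ereal t < f y}" for t
  proof -
    have "{y. ereal t < f y} = - {y. f y \<le> ereal t}"
      by auto
    then show ?thesis
      using closed by (simp add: open_Compl)
  qed
  have "C \<subseteq> (\<Union>t\<in>T. {y. ereal t < f y})"
  proof
    fix y assume "y \<in> C"
    with no_min obtain y' where "y' \<in> C" "f y' < f y"
      by (meson not_le)
    then obtain t where "f y' < ereal t" "ereal t < f y"
      using ereal_dense2 by blast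
    with \<open>y' \<in> C\<close> show "y \<in> (\<Union>t\<in>T. {y. ereal t < f y})"
      unfolding T_def by blast
  qed
  then obtain T' where T': "T' \<subseteq> T" "finite T'" "C \<subseteq> (\<Union>t\<in>T'. {y. ereal t < f y})"
    using compactE_image[OF \<open>compact C\<close>, of T "\<lambda>t. {y. ereal t < f y}"] op by blast
  have "T' \<noteq> {}"
    using T'(3) \<open>C \<noteq> {}\<close> by auto
  then have "Min T' \<in> T"
    using T' Min_in by blast
  then obtain y where y: "y \<in> C" "f y < ereal (Min T')"
    by (auto simp: T_def)
  then obtain t where "t \<in> T'" "ereal t < f y"
    using T'(3) by blast
  moreover from this T'(2) have "ereal (Min T') \<le> ereal t"
    by simp
  ultimately show False
    using y(2) by (meson leD le_less_trans less_imp_le)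
qed

text \<open>Moving the real number \<open>q y\<close> to the right-hand side exhibits the set as a
  preimage of the epigraph of \<open>g\<close> under a continuous map.\<close>

lemma closed_fun_sublevel_add_continuous:
  fixes g :: "'a::topological_space \<Rightarrow> ereal"
  assumes "closed_fun g" and cont: "continuous_on UNIV q"
  shows "closed {y. g y + ereal (q y) \<le> ereal t}"
proof -
  have eq: "{y. g y + ereal (q y) \<le> ereal t} = (\<lambda>y. (y, t - q y)) -` {(x, t::real). g x \<le> ereal t}"
  proof -
    have "g y + ereal (q y) \<le> ereal t \<longleftrightarrow> g y \<le> ereal (t - q y)" for y
      by (cases "g y") auto
    then show ?thesis
      by auto
  qed
  have "continuous_on UNIV (\<lambda>y. (y, t - q y))"
    by (intro continuous_intros cont)
  then show ?thesis
    unfolding eq using assms(1) unfolding closed_fun_def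
    by (intro closed_vimage) auto
qed

text \<open>
  Compare \<open>g\<close> at \<open>y\<close> with its minimum over the unit ball at \<open>x\<^sub>0\<close>, using convexity on the
  segment from \<open>x\<^sub>0\<close> to \<open>y\<close>.
\<close>

lemma convex_fun_linear_minorant:
  fixes g :: "'a::euclidean_space \<Rightarrow> ereal"
  assumes "closed_fun g" and "convex_fun g" and "proper_fun g"
  shows "\<exists>x0 a b. g x0 = ereal a \<and> (\<forall>y. ereal (a - b - b * norm (y - x0)) \<le> g y)"
proof -
  obtain x0 a where x0: "g x0 = ereal a"
    using \<open>proper_fun g\<close> unfolding proper_fun_def by (metis ereal_cases)
  have "closed {y. g y \<le> ereal t}" for t
    using closed_fun_sublevel_add_continuous[OF \<open>closed_fun g\<close>, of "\<lambda>_. 0" t]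
    by (simp add: zero_ereal_def[symmetric])
  then obtain v where v: "\<forall>y\<in>cball x0 1. g v \<le> g y"
    using compact_attains_inf_of_closed_sublevels[of "cball x0 1" g] by fastforce
  moreover have "x0 \<in> cball x0 1"
    by simp
  ultimately have "g v \<le> ereal a"
    using x0 by metis
  then obtain m where m: "g v = ereal m" and "m \<le> a"
    using \<open>proper_fun g\<close> unfolding proper_fun_def by (cases "g v") auto
  \<comment> \<open>The drop \<open>a - m\<close> from the centre to the ball minimum serves both as
    offset, which suffices inside the ball, and as slope outside it.\<close>
  have "ereal (a - (a - m) - (a - m) * norm (y - x0)) \<le> g y" for y
  proof (cases "norm (y - x0) \<le> 1")
    case True
    then have "y \<in> cball x0 1"
      by (simp add: dist_norm norm_minus_commute)
    with v m have "ereal m \<le> g y"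
      by metis
    moreover have "0 \<le> (a - m) * norm (y - x0)"
      using \<open>m \<le> a\<close> by simp
    ultimately have "ereal (a - (a - m) - (a - m) * norm (y - x0)) \<le> ereal m" "ereal m \<le> g y"
      by simp_all
    then show ?thesis
      by (rule order_trans)
  next
    case False
    define r where "r = norm (y - x0)"
    have r: "r > 1"
      using False by (simp add: r_def)
    \<comment> \<open>This is where the segment from \<open>x0\<close> to \<open>y\<close> leaves
      the unit ball, so \<open>m \<le> g w\<close>.\<close>
    define w where "w = (1 / r) *\<^sub>R y + (1 - 1 / r) *\<^sub>R x0"
    have "w - x0 = (1 / r) *\<^sub>R (y - x0)"
      by (simp add: w_def algebra_simps)
    then have "norm (w - x0) = 1"
      using r by (auto simp: r_def)
    then have "w \<in> cball x0 1"
      by (simp add: dist_norm norm_minus_commute)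
    then have "ereal m \<le> g w"
      using v m by metis
    also have "g w \<le> ereal (1 / r) * g y + ereal (1 - 1 / r) * g x0"
      using \<open>convex_fun g\<close> r unfolding convex_fun_def w_def by simp
    finally have *: "ereal m \<le> ereal (1 / r) * g y + ereal (1 - 1 / r) * ereal a"
      by (simp add: x0)
    show ?thesis
    proof (cases "g y")
      case (real b)
      with * have "m \<le> b / r + (1 - 1 / r) * a"
        by simp
      then have "r * m \<le> r * (b / r + (1 - 1 / r) * a)"
        using r by (intro mult_left_mono) auto
      also have "\<dots> = b + (r - 1) * a"
        using r by (simp add: field_simps)
      finally have "r * m \<le> b + (r - 1) * a" .
      moreover have "m \<le> a"
        by fact
      ultimately have "a - (a - m) - (a - m) * r \<le> b"
        by (simp add: algebra_simps)
      then show ?thesis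
        by (simp add: real r_def)
    next
      case PInf
      then show ?thesis by simp
    next
      case MInf
      then show ?thesis
        using \<open>proper_fun g\<close> unfolding proper_fun_def by auto
    qed
  qed
  then show ?thesis
    using x0 by blast
qed

text \<open>The quadratic term outgrows the linear minorant, so far from \<open>x\<close> the
  objective is no smaller than at \<open>x0\<close>; a minimizer over a large ball containing
  \<open>x0\<close> is therefore global.\<close>

lemma prox_minimizer_exists:
  fixes g :: "'a::euclidean_space \<Rightarrow> ereal"
  assumes "lam > 0" and "closed_fun g" and "convex_fun g" and "proper_fun g"
  shows "\<exists>m. \<forall>y. g m + ereal (1 / (2 * lam) * (norm (m - x))\<^sup>2)
               \<le> g y + ereal (1 / (2 * lam) * (norm (y - x))\<^sup>2)"
proof -
  define h where "h y = g y + ereal (1 / (2 * lam) * (norm (y - x))\<^sup>2)" for y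
  obtain x0 a b where x0: "g x0 = ereal a"
    and lower: "\<And>y. ereal (a - b - b * norm (y - x0)) \<le> g y"
    using convex_fun_linear_minorant assms by blast
  define D where "D = norm (x0 - x)"
  define c where "c = \<bar>b\<bar>"
  \<comment> \<open>With \<open>r = norm (y - x)\<close>, the minorant yields
    \<open>h x0 \<le> h y\<close> once \<open>c * r + M\<close> is at most
    \<open>r\<^sup>2 / (2 * lam)\<close>. Beyond \<open>R\<close> this holds, since there
    \<open>r \<ge> 1\<close> and \<open>r \<ge> 2 * lam * (c + M)\<close>. The summand
    \<open>D\<close> in \<open>R\<close> keeps \<open>x0\<close> in the ball.\<close>
  define M where "M = c + c * D + 1 / (2 * lam) * D\<^sup>2"
  define R where "R = 1 + D + 2 * lam * (c + M)"
  have "D \<ge> 0" "c \<ge> 0"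
    by (simp_all add: D_def c_def)
  then have "M \<ge> 0"
    using assms(1) by (simp add: M_def)
  have far: "h x0 \<le> h y" if "R < norm (y - x)" for y
  proof -
    define r where "r = norm (y - x)"
    have "r > R"
      using that by (simp add: r_def)
    moreover have "0 \<le> 2 * lam * (c + M)"
      using assms(1) \<open>c \<ge> 0\<close> \<open>M \<ge> 0\<close> by simp
    ultimately have "r \<ge> 1" and big: "2 * lam * (c + M) \<le> r"
      using \<open>D \<ge> 0\<close> by (auto simp: R_def)
    have "norm (y - x0) \<le> r + D"
      unfolding r_def D_def by norm
    then have "b * norm (y - x0) \<le> c * (r + D)"
      unfolding c_def by (intro mult_mono) auto
    moreover have "c * r + M \<le> 1 / (2 * lam) * r\<^sup>2"
    proof -
      have "M \<le> M * r"
        using \<open>M \<ge> 0\<close> \<open>r \<ge> 1\<close> mult_left_mono[of 1 r M] by simp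
      then have "c * r + M \<le> (c + M) * r"
        by (simp add: algebra_simps)
      also have "\<dots> \<le> (1 / (2 * lam) * r) * r"
        using big assms(1) \<open>r \<ge> 1\<close> by (intro mult_right_mono) (auto simp: field_simps)
      finally show ?thesis
        by (simp add: power2_eq_square)
    qed
    ultimately have "a + 1 / (2 * lam) * D\<^sup>2 \<le> (a - b - b * norm (y - x0)) + 1 / (2 * lam) * r\<^sup>2"
      unfolding M_def c_def by (simp add: algebra_simps)
    then have "h x0 \<le> ereal (a - b - b * norm (y - x0)) + ereal (1 / (2 * lam) * r\<^sup>2)"
      by (simp add: h_def x0 D_def)
    also have "\<dots> \<le> h y"
      unfolding h_def r_def by (intro add_mono lower order_refl)
    finally show ?thesis .
  qed
  have "R \<ge> D"
    using assms(1) \<open>c \<ge> 0\<close> \<open>M \<ge> 0\<close> by (simp add: R_def)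
  then have x0_in: "x0 \<in> cball x R"
    by (simp add: D_def dist_norm norm_minus_commute)
  have "closed {y. h y \<le> ereal t}" for t
    unfolding h_def
    by (intro closed_fun_sublevel_add_continuous continuous_intros assms)
  then obtain m where m: "\<forall>y\<in>cball x R. h m \<le> h y"
    using compact_attains_inf_of_closed_sublevels[of "cball x R" h] x0_in by fastforce
  have "h m \<le> h y" for y
  proof (cases "y \<in> cball x R")
    case False
    then have "R < norm (y - x)"
      by (simp add: dist_norm norm_minus_commute)
    then show ?thesis
      using far m x0_in order_trans by blast
  qed (use m in blast)
  then show ?thesis
    unfolding h_def by blast
qed

section \<open>Optimality of the proximal point\<close>

lemma prox_minimal:
  fixes g :: "'a::euclidean_space \<Rightarrow> ereal"
  assumes "lam > 0" and "closed_fun g" and "convex_fun g" and "proper_fun g"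
  shows "g (prox lam g x) + ereal (1 / (2 * lam) * (norm (prox lam g x - x))\<^sup>2)
           \<le> g y + ereal (1 / (2 * lam) * (norm (y - x))\<^sup>2)"
proof -
  let ?h = "\<lambda>y. g y + ereal (1 / (2 * lam) * (norm (y - x))\<^sup>2)"
  obtain m where "\<forall>y. ?h m \<le> ?h y"
    using prox_minimizer_exists[OF assms, of x] by blast
  then have "is_arg_min ?h (\<lambda>_. True) m"
    unfolding is_arg_min_def by (simp add: not_less)
  then have "is_arg_min ?h (\<lambda>_. True) (prox lam g x)"
    unfolding prox_def arg_min_def by (rule someI)
  then show ?thesis
    unfolding is_arg_min_def by (simp add: not_less)
qed

lemma prox_finite:
  fixes g :: "'a::euclidean_space \<Rightarrow> ereal"
  assumes "lam > 0" and "closed_fun g" and "convex_fun g" and "proper_fun g"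
  shows "\<bar>g (prox lam g x)\<bar> \<noteq> \<infinity>"
proof -
  obtain v where "g v \<noteq> \<infinity>"
    using assms(4) unfolding proper_fun_def by blast
  then have "g (prox lam g x) \<noteq> \<infinity>"
    using prox_minimal[OF assms, of x v] by auto
  moreover have "g (prox lam g x) \<noteq> -\<infinity>"
    using assms(4) unfolding proper_fun_def by blast
  ultimately show ?thesis
    by auto
qed

text \<open>First-order optimality: compare the proximal point with a point at fraction
  \<open>\<theta>\<close> of the way to \<open>v\<close>, bound \<open>g\<close> there by convexity,
  divide by \<open>\<theta>\<close> and let it tend to 0 from the right.\<close>

lemma prox_grad_subgradient:
  fixes g :: "'a::euclidean_space \<Rightarrow> ereal"
  assumes "lam > 0" and "closed_fun g" and "convex_fun g" and "proper_fun g"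
    and "\<bar>g v\<bar> \<noteq> \<infinity>"
  shows "real_of_ereal (g (prox lam g x)) + prox_grad lam g x \<bullet> (v - prox lam g x)
           \<le> real_of_ereal (g v)"
proof -
  define y where "y = prox lam g x"
  obtain b where b: "g v = ereal b"
    using assms(5) by auto
  obtain a where a: "g y = ereal a"
    using prox_finite[OF assms(1-4), of x] unfolding y_def by auto
  \<comment> \<open>The claim is exactly \<open>A \<le> 0\<close>; \<open>B\<close> is the
    second-order remainder from expanding the square.\<close>
  define A where "A = a - b - (1 / lam) * ((y - x) \<bullet> (v - y))"
  define B where "B = 1 / (2 * lam) * (norm (v - y))\<^sup>2"
  have small: "A \<le> \<theta> * B" if "0 < \<theta>" "\<theta> < 1" for \<theta>
  proof -
    define w where "w = \<theta> *\<^sub>R v + (1 - \<theta>) *\<^sub>R y"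
    have "w - x = (y - x) + \<theta> *\<^sub>R (v - y)"
      by (simp add: w_def algebra_simps)
    then have sq: "(norm (w - x))\<^sup>2
        = (norm (y - x))\<^sup>2 + 2 * \<theta> * ((y - x) \<bullet> (v - y)) + \<theta>\<^sup>2 * (norm (v - y))\<^sup>2"
      by (simp only: power2_norm_eq_inner inner_add_left inner_add_right
          inner_scaleR_left inner_scaleR_right inner_commute[of "v - y" "y - x"])
        (simp add: power2_eq_square distrib_left)
    have "g y + ereal (1 / (2 * lam) * (norm (y - x))\<^sup>2)
        \<le> g w + ereal (1 / (2 * lam) * (norm (w - x))\<^sup>2)"
      unfolding y_def by (rule prox_minimal[OF assms(1-4)])
    also have "\<dots> \<le> (ereal \<theta> * g v + ereal (1 - \<theta>) * g y)
        + ereal (1 / (2 * lam) * (norm (w - x))\<^sup>2)"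
      using assms(3) that unfolding convex_fun_def w_def by (intro add_right_mono) auto
    finally have "a + 1 / (2 * lam) * (norm (y - x))\<^sup>2
        \<le> \<theta> * b + (1 - \<theta>) * a + 1 / (2 * lam) * (norm (w - x))\<^sup>2"
      by (simp add: a b)
    moreover have "1 / (2 * lam) * (norm (w - x))\<^sup>2 = 1 / (2 * lam) * (norm (y - x))\<^sup>2
        + \<theta> * ((1 / lam) * ((y - x) \<bullet> (v - y))) + \<theta> * (\<theta> * B)"
      using assms(1) unfolding sq B_def by (simp add: field_simps power2_eq_square)
    ultimately have "\<theta> * A \<le> \<theta> * (\<theta> * B)"
      unfolding A_def by (simp add: algebra_simps)
    then show ?thesis
      using that by simp
  qed
  have "((\<lambda>\<theta>. \<theta> * B) \<longlongrightarrow> 0 * B) (at_right 0)"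
    by (intro tendsto_intros)
  moreover have "\<forall>\<^sub>F \<theta> in at_right 0. A \<le> \<theta> * B"
    using small unfolding eventually_at_right_field by (intro exI[of _ 1]) auto
  ultimately have "A \<le> 0"
    by (simp add: tendsto_lowerbound)
  moreover have "prox_grad lam g x \<bullet> (v - y) = - ((1 / lam) * ((y - x) \<bullet> (v - y)))"
    unfolding prox_grad_def y_def by simp
  ultimately show ?thesis
    unfolding y_def[symmetric] by (simp add: a b A_def)
qed

section \<open>Monotonicity of the Lyapunov function and the gradient bound\<close>

text \<open>Primes mark index \<open>k + 1\<close>. Add \<open>\<tau>\<close> times
  \<open>sub_p\<close> to \<open>d\<close> times \<open>sub_v\<close>: the inner products cancel
  against the change of \<open>w \<bullet> (z - v) / lam\<close>, except for
  \<open>(a * d - \<tau>') * lam * (u \<bullet> u)\<close>, which is nonpositive.\<close>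

lemma lyapunov_step:
  fixes u w z p x y z' w' v :: "'a::real_inner" and lam \<phi> \<phi>' \<tau> \<tau>' a d Gp Gy Gv :: real
  assumes "lam > 0" and "\<tau> \<ge> 0" and "d \<ge> 0" and "\<tau>' = \<tau> + d"
    and "a = \<tau> * \<phi> - \<tau>' * \<phi>'" and "a * d \<le> \<tau>'"
    and p: "p = z - \<phi> *\<^sub>R w" and x: "x = z - \<phi>' *\<^sub>R w" and y: "y = x - lam *\<^sub>R u"
    and z': "z' = z - (a * lam) *\<^sub>R u" and w': "w' = w - (d * lam) *\<^sub>R u"
    and sub_p: "Gy + u \<bullet> (p - y) \<le> Gp" and sub_v: "Gy + u \<bullet> (v - y) \<le> Gv"
  shows "\<tau>' * (Gy - Gv) + w' \<bullet> (z' - v) / lam \<le> \<tau> * (Gp - Gv) + w \<bullet> (z - v) / lam"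
proof -
  have "w' \<bullet> (z' - v) = w \<bullet> (z - v)
      + lam * (a * d * lam * (u \<bullet> u) - d * (u \<bullet> (z - v)) - a * (u \<bullet> w))"
    unfolding z' w' by (simp add: inner_diff_left inner_diff_right inner_commute algebra_simps)
  then have V: "w' \<bullet> (z' - v) / lam = w \<bullet> (z - v) / lam
      + a * d * lam * (u \<bullet> u) - d * (u \<bullet> (z - v)) - a * (u \<bullet> w)"
    using \<open>lam > 0\<close> by (simp add: add_divide_distrib)
  \<comment> \<open>The coefficient of \<open>u \<bullet> w\<close> is
    \<open>\<tau> * (\<phi>' - \<phi>) + d * \<phi>'\<close>, which equals
    \<open>- a\<close>.\<close>
  have T: "\<tau> * (u \<bullet> (p - y)) + d * (u \<bullet> (v - y))
      = \<tau>' * lam * (u \<bullet> u) - d * (u \<bullet> (z - v)) - a * (u \<bullet> w)"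
    unfolding p y x assms(4,5)
    by (simp add: inner_diff_left inner_diff_right inner_commute algebra_simps)
  have "\<tau> * (Gy + u \<bullet> (p - y)) \<le> \<tau> * Gp" "d * (Gy + u \<bullet> (v - y)) \<le> d * Gv"
    using sub_p sub_v \<open>\<tau> \<ge> 0\<close> \<open>d \<ge> 0\<close> by (auto intro: mult_left_mono)
  moreover have "a * d * (lam * (u \<bullet> u)) \<le> \<tau>' * (lam * (u \<bullet> u))"
    using assms(1,6) by (intro mult_right_mono) auto
  ultimately show ?thesis
    using V T unfolding assms(4) by (simp add: algebra_simps)
qed

lemma prox_eq: "lam > 0 \<Longrightarrow> prox lam g x = x - lam *\<^sub>R prox_grad lam g x"
  by (simp add: prox_grad_def algebra_simps)

text \<open>Taking the value at the last proximal point instead of the infimum keeps everything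
  real, even when \<open>g\<close> is unbounded below.\<close>

lemma g_guler_g_gradient_bound:
  fixes g :: "'a::euclidean_space \<Rightarrow> ereal" and x z :: "nat \<Rightarrow> 'a"
  assumes lam: "lam > 0"
    and g: "closed_fun g" "convex_fun g" "proper_fun g"
    and \<phi>_nonneg: "\<forall>k\<le>K + 1. \<phi> k \<ge> 0"
    and \<tau>_nonneg: "\<forall>k\<le>K. \<tau> k \<ge> 0"
    and mono: "mono_on {..K} \<tau>"
    and last: "\<phi> (K + 1) = 0" "\<phi> K = 1" "\<tau> K = 1"
    and step: "\<forall>k<K. \<tau> k * \<phi> k - \<tau> (k + 1) * \<phi> (k + 1) = \<phi> (k + 1) * (\<tau> (k + 1) - \<tau> k) + 1"
    and step_le: "\<forall>k<K. (\<tau> k * \<phi> k - \<tau> (k + 1) * \<phi> (k + 1)) * (\<tau> (k + 1) - \<tau> k) \<le> \<tau> (k + 1)"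
    and iter: "g_guler_g lam g K \<phi> \<tau> x z"
    and x0: "\<bar>g (x 0)\<bar> \<noteq> \<infinity>"
  shows "lam * (norm (prox_grad lam g (x K)))\<^sup>2
           \<le> \<tau> 0 * (real_of_ereal (g (x 0)) - real_of_ereal (g (prox lam g (x K))))"
proof -
  define G where "G v = real_of_ereal (g v)" for v
  define y where "y k = prox lam g (x k)" for k
  define p where "p k = prev_prox lam g x k" for k
  define u where "u k = prox_grad lam g (x k)" for k
  define w where "w k = (1 / \<phi> k) *\<^sub>R (z k - p k)" for k
  define d where "d k = \<tau> (Suc k) - \<tau> k" for k
  define a where "a k = \<tau> k * \<phi> k - \<tau> (Suc k) * \<phi> (Suc k)" for k
  define U where "U k = \<tau> k * (G (p k) - G (y K)) + w k \<bullet> (z k - y K) / lam" for k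
  have d_nonneg: "d k \<ge> 0" if "k < K" for k
    using mono that unfolding d_def mono_on_def by auto
  have a_eq: "a k = \<phi> (Suc k) * d k + 1" if "k < K" for k
    using step that unfolding a_def d_def by auto
  \<comment> \<open>Needed to cancel the divisions by \<open>\<phi> k\<close>. The summand 1 in the
    parameter recursion excludes zero.\<close>
  have \<phi>_pos: "\<phi> k > 0" if "k \<le> K" for k
  proof (cases "k = K")
    case False
    with that have "k < K" by simp
    then have "\<tau> k * \<phi> k = \<tau> (Suc k) * \<phi> (Suc k) + \<phi> (Suc k) * d k + 1"
      using a_eq[of k] unfolding a_def by simp
    moreover have "0 \<le> \<tau> (Suc k) * \<phi> (Suc k)" "0 \<le> \<phi> (Suc k) * d k"
      using \<open>k < K\<close> \<phi>_nonneg \<tau>_nonneg d_nonneg by auto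
    ultimately have "\<phi> k \<noteq> 0"
      by auto
    then show ?thesis
      using \<phi>_nonneg that by (simp add: less_le)
  qed (use last in simp)
  have y_eq: "y k = x k - lam *\<^sub>R u k" for k
    unfolding y_def u_def using lam by (rule prox_eq)
  have y_finite: "\<bar>g (y k)\<bar> \<noteq> \<infinity>" for k
    unfolding y_def by (rule prox_finite[OF lam g])
  have p_0: "p 0 = x 0" and p_Suc: "p (Suc k) = y k" for k
    by (simp_all add: p_def y_def prev_prox_def)
  have p_finite: "\<bar>g (p k)\<bar> \<noteq> \<infinity>" for k
    using x0 y_finite by (cases k) (auto simp: p_0 p_Suc)
  have subgrad: "G (y k) + u k \<bullet> (v - y k) \<le> G v" if "\<bar>g v\<bar> \<noteq> \<infinity>" for k v
    unfolding G_def y_def u_def using prox_grad_subgradient[OF lam g that] .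
  have z_0: "z 0 = x 0"
    using iter unfolding g_guler_g_def by blast
  have p_eq: "p k = z k - \<phi> k *\<^sub>R w k" if "k \<le> K" for k
    using \<phi>_pos[OF that] unfolding w_def by simp
  have x_eq: "x k = z k - \<phi> (Suc k) *\<^sub>R w k" if "k \<le> K" for k
  proof -
    have "x k = (\<phi> (Suc k) / \<phi> k) *\<^sub>R p k + (1 - \<phi> (Suc k) / \<phi> k) *\<^sub>R z k"
      using iter that unfolding g_guler_g_def p_def by simp
    then show ?thesis
      unfolding w_def by (simp add: algebra_simps)
  qed
  have z_Suc: "z (Suc k) = z k - (a k * lam) *\<^sub>R u k" if "k < K" for k
    using iter that unfolding g_guler_g_def a_def u_def by simp
  \<comment> \<open>Subtracting \<open>y k\<close> from \<open>z (Suc k)\<close> leaves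
    \<open>\<phi> (Suc k) *\<^sub>R w k - ((a k - 1) * lam) *\<^sub>R u k\<close>, and
    \<open>a k - 1\<close> is \<open>\<phi> (Suc k) * d k\<close>.\<close>
  have w_Suc: "w (Suc k) = w k - (d k * lam) *\<^sub>R u k" if "k < K" for k
  proof -
    have "z (Suc k) - p (Suc k) = \<phi> (Suc k) *\<^sub>R (w k - (d k * lam) *\<^sub>R u k)"
      unfolding p_Suc y_eq z_Suc[OF that] x_eq[OF less_imp_le[OF that]] a_eq[OF that]
      by (simp add: algebra_simps)
    then show ?thesis
      using \<phi>_pos[of "Suc k"] that unfolding w_def[of "Suc k"] by simp
  qed
  have decrease: "U (Suc k) \<le> U k" if "k < K" for k
    unfolding U_def p_Suc
  proof (rule lyapunov_step[where d = "d k" and a = "a k" and u = "u k" and p = "p k"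
        and x = "x k" and \<phi> = "\<phi> k" and \<phi>' = "\<phi> (Suc k)"])
    show "a k * d k \<le> \<tau> (Suc k)"
      using step_le that unfolding a_def d_def by simp
    show "x k = z k - \<phi> (Suc k) *\<^sub>R w k" "p k = z k - \<phi> k *\<^sub>R w k"
      using x_eq p_eq that by simp_all
  qed (use that lam \<tau>_nonneg d_nonneg y_eq z_Suc w_Suc subgrad p_finite y_finite
       in \<open>auto simp: a_def d_def\<close>)
  have "U k \<le> U 0" if "k \<le> K" for k
    using that
  proof (induction k)
    case (Suc k)
    then show ?case
      using decrease[of k] by simp
  qed simp
  then have "U K \<le> U 0"
    by simp
  \<comment> \<open>Here \<open>w 0 = 0\<close>, since \<open>z 0\<close> and \<open>p 0\<close> are
    both \<open>x 0\<close>.\<close>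
  moreover have "U 0 = \<tau> 0 * (G (x 0) - G (y K))"
    unfolding U_def w_def by (simp add: p_0 z_0)
  moreover have "lam * (norm (u K))\<^sup>2 \<le> U K"
  proof -
    \<comment> \<open>\<open>\<phi> (K + 1) = 0\<close> forces \<open>x K = z K\<close>; next,
      \<open>\<phi> K = 1\<close> gives \<open>w K = z K - p K\<close>.\<close>
    have z_K: "z K = y K + lam *\<^sub>R u K"
      using x_eq[of K] y_eq[of K] last by simp
    have "w K \<bullet> (z K - y K) / lam = u K \<bullet> (z K - p K)"
      using lam last unfolding w_def by (simp add: z_K inner_commute)
    also have "\<dots> = lam * (norm (u K))\<^sup>2 - u K \<bullet> (p K - y K)"
      unfolding z_K power2_norm_eq_inner by (simp add: inner_diff_right inner_add_right)
    finally show ?thesis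
      using subgrad[OF p_finite, of K K] last unfolding U_def by simp
  qed
  ultimately show ?thesis
    unfolding G_def u_def y_def by linarith
qed

theorem theorem9:
  fixes lam :: real
    and g :: "real ^ 'n \<Rightarrow> ereal"
    and K :: nat
    and \<phi> \<tau> :: "nat \<Rightarrow> real"
    and x z :: "nat \<Rightarrow> real ^ 'n"
  assumes "lam > 0"
    and "closed_fun g" and "convex_fun g" and "proper_fun g"
    and "K \<ge> 1"
    and "\<forall>k\<le>K + 1. \<phi> k \<ge> 0"
    and "\<forall>k\<le>K. \<tau> k \<ge> 0"
    and "mono_on {..K} \<tau>"
    and "\<phi> (K + 1) = 0" and "\<phi> K = 1" and "\<tau> K = 1"
    and "\<forall>k<K. \<tau> k * \<phi> k - \<tau> (k + 1) * \<phi> (k + 1) = \<phi> (k + 1) * (\<tau> (k + 1) - \<tau> k) + 1"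
    and "\<forall>k<K. (\<tau> k * \<phi> k - \<tau> (k + 1) * \<phi> (k + 1)) * (\<tau> (k + 1) - \<tau> k) \<le> \<tau> (k + 1)"
    and "g_guler_g lam g K \<phi> \<tau> x z"
  shows "ereal ((norm (prox_grad lam g (x K)))\<^sup>2)
           \<le> ereal (\<tau> 0 / lam) * (g (x 0) - (INF y. g y))"
proof -
  \<comment> \<open>Strict positivity of \<open>\<tau> 0\<close> matters when
    \<open>g (x 0) = \<infinity>\<close>: in \<open>ereal\<close>, zero times infinity is
    zero.\<close>
  have "\<tau> 0 * \<phi> 0 = \<tau> 1 * \<phi> 1 + \<phi> 1 * (\<tau> 1 - \<tau> 0) + 1"
    using assms(5,12) by (auto simp: algebra_simps)
  moreover have "\<tau> 0 \<le> \<tau> 1"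
    using assms(5,8) unfolding mono_on_def by auto
  moreover have "\<phi> 1 \<ge> 0" "\<tau> 1 \<ge> 0" "\<tau> 0 \<ge> 0"
    using assms(5-7) by auto
  ultimately have "\<tau> 0 * \<phi> 0 \<ge> 1"
    by simp
  then have \<tau>_pos: "\<tau> 0 > 0"
    using \<open>\<tau> 0 \<ge> 0\<close> by (cases "\<tau> 0 = 0") auto
  obtain c where c: "g (prox lam g (x K)) = ereal c"
    using prox_finite[OF assms(1-4), of "x K"] by auto
  have inf_le: "(INF y. g y) \<le> ereal c"
    unfolding c[symmetric] by (rule INF_lower) simp
  show ?thesis
  proof (cases "g (x 0)")
    case (real b)
    have "lam * (norm (prox_grad lam g (x K)))\<^sup>2 \<le> \<tau> 0 * (b - c)"
      using g_guler_g_gradient_bound[OF assms(1-4,6-14)] by (simp add: real c)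
    then have "(norm (prox_grad lam g (x K)))\<^sup>2 \<le> \<tau> 0 / lam * (b - c)"
      using assms(1) by (simp add: field_simps)
    then have "ereal ((norm (prox_grad lam g (x K)))\<^sup>2) \<le> ereal (\<tau> 0 / lam) * (ereal b - ereal c)"
      by simp
    also have "\<dots> \<le> ereal (\<tau> 0 / lam) * (g (x 0) - (INF y. g y))"
      using \<tau>_pos assms(1) inf_le unfolding real
      by (intro ereal_mult_left_mono ereal_minus_mono) auto
    finally show ?thesis .
  next
    case PInf
    \<comment> \<open>The infimum lies below the finite \<open>c\<close>, so the difference is never
      \<open>\<infinity> - \<infinity>\<close>.\<close>
    have "g (x 0) - (INF y. g y) = \<infinity>"
      using inf_le PInf by (cases "INF y. g y") auto
    then show ?thesis
      using \<tau>_pos assms(1) by simp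
  next
    case MInf
    then show ?thesis
      using assms(4) unfolding proper_fun_def by auto
  qed
qed

end
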